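(* Let $X$ be a separable complex Banach space and let $T$ be a bounded linear operator on $X$. If there exists a real number $p\ge 1$ such that both $$A=\operatorname{span}\{x\in X: Tx=\alpha x\text{ for some }\alpha\in\mathbb{C},\ |\alpha|<p\}$$ and $$B=\operatorname{span}\{y\in X: Ty=\lambda y\text{ for some }\lambda\in\mathbb{C},\ |\lambda|>p\}$$ are dense in $X$, then $T$ is compound.
   Context: $\mathbb{D}=\{z\in\mathbb{C}:|z|\le 1\}$ is the closed unit disk; $\mathbb{N}$ is the set of positive integers; $\operatorname{span}$ denotes the linear span. Definition (compound): a bounded linear operator $T$ on $X$ is compound if for all nonempty open sets $U,V\subset X$ there exist $N\in\mathbb{N}$ and a sequence $(\alpha_n)\subset\mathbb{D}\setminus\{0\}$ such that $T^n(\alpha_nU)\cap V\neq\emptyset$ for all $n\ge N$. *)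

theory Defs
  imports "HOL-Analysis.Analysis"
begin

class complex_normed_vector = real_normed_vector +
  fixes scaleC :: "complex \<Rightarrow> 'a \<Rightarrow> 'a"  (infixr \<open>*\<^sub>C\<close> 75)
  assumes scaleC_add_right: "a *\<^sub>C (x + y) = a *\<^sub>C x + a *\<^sub>C y"
    and scaleC_add_left: "(a + b) *\<^sub>C x = a *\<^sub>C x + b *\<^sub>C x"
    and scaleC_scaleC: "a *\<^sub>C (b *\<^sub>C x) = (a * b) *\<^sub>C x"
    and scaleC_one: "1 *\<^sub>C x = x"
    and scaleR_scaleC: "r *\<^sub>R x = complex_of_real r *\<^sub>C x"
    and norm_scaleC: "norm (a *\<^sub>C x) = cmod a * norm x"

class complex_banach = complex_normed_vector + complete_space

subclass (in complex_banach) banach ..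

instantiation complex :: complex_banach
begin

definition scaleC_complex :: "complex \<Rightarrow> complex \<Rightarrow> complex"
  where "scaleC_complex a x = a * x"

instance
  by standard
    (auto simp: scaleC_complex_def algebra_simps norm_mult scaleR_conv_of_real)

end

global_interpretation complex_vector: vector_space
  "scaleC :: complex \<Rightarrow> 'a \<Rightarrow> 'a::complex_normed_vector"
  defines cspan = complex_vector.span
  by unfold_locales
    (auto simp: scaleC_add_right scaleC_add_left scaleC_scaleC scaleC_one)

text \<open>Boundedness does not depend on the scalar field, so the library's real notion is
  combined with complex linearity.\<close>

definition bounded_clinear ::
    "('a::complex_normed_vector \<Rightarrow> 'b::complex_normed_vector) \<Rightarrow> bool"
  where "bounded_clinear T \<longleftrightarrow>
    Vector_Spaces.linear scaleC scaleC T \<and> bounded_linear T"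

text \<open>Only the values of \<open>\<alpha>\<close> at positive indices matter: sequences are indexed by the
  positive integers.\<close>

definition compound :: "('a::complex_normed_vector \<Rightarrow> 'a) \<Rightarrow> bool"
  where "compound T \<longleftrightarrow>
    (\<forall>U V. open U \<and> U \<noteq> {} \<and> open V \<and> V \<noteq> {} \<longrightarrow>
      (\<exists>N\<ge>1. \<exists>\<alpha>::nat \<Rightarrow> complex.
        (\<forall>n\<ge>1. \<alpha> n \<in> cball 0 1 - {0}) \<and>
        (\<forall>n\<ge>N. (T ^^ n) ` ((\<lambda>x. \<alpha> n *\<^sub>C x) ` U) \<inter> V \<noteq> {})))"

end

theory Submission
  imports Defs
begin

text \<open>Pick \<open>x \<in> A \<inter> U\<close> and \<open>y \<in> B \<inter> V\<close>. Dividing the eigenvector components of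
  \<open>y\<close> by the \<open>n\<close>-th powers of their eigenvalues gives \<open>w\<^sub>n\<close> with \<open>T\<^sup>n w\<^sub>n = y\<close> and
  \<open>p\<^sup>n w\<^sub>n \<rightarrow> 0\<close>, while \<open>p\<^sup>-\<^sup>n T\<^sup>n x \<rightarrow> 0\<close>. Hence \<open>u\<^sub>n = x + p\<^sup>n w\<^sub>n\<close> tends to \<open>x\<close>, and
  with \<open>\<alpha>\<^sub>n = p\<^sup>-\<^sup>n\<close>, which lies in the unit disk because \<open>p \<ge> 1\<close>, the vectors
  \<open>T\<^sup>n (\<alpha>\<^sub>n u\<^sub>n) = p\<^sup>-\<^sup>n T\<^sup>n x + y\<close> tend to \<open>y\<close>.\<close>

lemma clinear_funpow:
  fixes T :: "'a::complex_normed_vector \<Rightarrow> 'a"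
  assumes "Vector_Spaces.linear scaleC scaleC T"
  shows "Vector_Spaces.linear scaleC scaleC (T ^^ n)"
proof (induction n)
  case 0
  show ?case by (simp add: complex_vector.linear_ident id_def)
next
  case (Suc n)
  then show ?case
    using Vector_Spaces.linear_compose[OF Suc assms] by (simp add: o_def)
qed

lemma funpow_eigenvector:
  fixes T :: "'a::complex_normed_vector \<Rightarrow> 'a"
  assumes "Vector_Spaces.linear scaleC scaleC T" and "T x = \<alpha> *\<^sub>C x"
  shows "(T ^^ n) x = \<alpha> ^ n *\<^sub>C x"
proof (induction n)
  case 0
  show ?case by (simp add: scaleC_one)
next
  case (Suc n)
  interpret Vector_Spaces.linear scaleC scaleC T by fact
  show ?case by (simp add: Suc scale assms(2) scaleC_scaleC mult.commute)
qed

lemma tendsto_power_scaleC_zero: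
  assumes "cmod \<alpha> < 1"
  shows "(\<lambda>n. \<alpha> ^ n *\<^sub>C x) \<longlonglongrightarrow> 0"
proof -
  have "(\<lambda>n. cmod \<alpha> ^ n * norm x) \<longlonglongrightarrow> 0"
    using assms by (intro tendsto_mult_left_zero LIMSEQ_power_zero) simp
  then show ?thesis
    by - (rule tendsto_norm_zero_cancel, simp add: norm_scaleC norm_power)
qed

lemma tendsto_scaleC_zero:
  assumes "f \<longlonglongrightarrow> 0"
  shows "(\<lambda>n. c *\<^sub>C f n) \<longlonglongrightarrow> 0"
  using tendsto_mult_right_zero[OF tendsto_norm_zero[OF assms], of "cmod c"]
  by - (rule tendsto_norm_zero_cancel, simp add: norm_scaleC)

text \<open>On an eigenvector for \<alpha> the scaled orbit is geometric with ratio
  \<open>inverse c * \<alpha>\<close>, of modulus below 1. Decay to 0 passes to linear combinations,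
  so span induction adds one scaled eigenvector at a time.\<close>

lemma scaled_orbit_tendsto_zero:
  fixes T :: "'a::complex_normed_vector \<Rightarrow> 'a"
  assumes lin: "Vector_Spaces.linear scaleC scaleC T"
    and c: "c \<noteq> 0"
    and x: "x \<in> cspan {x. \<exists>\<alpha>. cmod \<alpha> < cmod c \<and> T x = \<alpha> *\<^sub>C x}"
  shows "(\<lambda>n. inverse c ^ n *\<^sub>C (T ^^ n) x) \<longlonglongrightarrow> 0"
  using x
proof (induction rule: complex_vector.span_induct_alt)
  case base
  have "(T ^^ n) 0 = 0" for n
  proof -
    interpret Vector_Spaces.linear scaleC scaleC "T ^^ n" by (rule clinear_funpow[OF lin])
    show ?thesis by (rule zero)
  qed
  then show ?case by simp
next
  case (step b x y)
  then obtain \<alpha> where \<alpha>: "cmod \<alpha> < cmod c" "T x = \<alpha> *\<^sub>C x" by blast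
  have "cmod (inverse c * \<alpha>) < 1"
    using \<alpha>(1) c by (simp add: norm_divide field_simps)
  then have "(\<lambda>n. b *\<^sub>C (inverse c * \<alpha>) ^ n *\<^sub>C x) \<longlonglongrightarrow> 0"
    by (intro tendsto_scaleC_zero tendsto_power_scaleC_zero)
  then have "(\<lambda>n. b *\<^sub>C (inverse c * \<alpha>) ^ n *\<^sub>C x + inverse c ^ n *\<^sub>C (T ^^ n) y) \<longlonglongrightarrow> 0"
    using step.IH by (rule tendsto_add_zero)
  moreover have "inverse c ^ n *\<^sub>C (T ^^ n) (b *\<^sub>C x + y) =
      b *\<^sub>C (inverse c * \<alpha>) ^ n *\<^sub>C x + inverse c ^ n *\<^sub>C (T ^^ n) y" for n
  proof -
    interpret Vector_Spaces.linear scaleC scaleC "T ^^ n" by (rule clinear_funpow[OF lin])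
    show ?thesis
      by (simp add: add scale funpow_eigenvector[OF lin \<alpha>(2)] scaleC_add_right scaleC_scaleC
          power_mult_distrib mult_ac)
  qed
  ultimately show ?case by simp
qed

text \<open>\<open>T\<close> may fail to be invertible, but on an eigenvector for \<mu> division by
  \<open>\<mu> ^ n\<close> yields a preimage under \<open>T ^^ n\<close>, and scaling by
  \<open>c ^ n\<close> leaves the ratio \<open>c * inverse \<mu>\<close>, of modulus below 1. Asking
  for a whole sequence \<open>w\<close> lets the induction add sequences termwise.\<close>

lemma scaled_backward_orbit_tendsto_zero:
  fixes T :: "'a::complex_normed_vector \<Rightarrow> 'a"
  assumes lin: "Vector_Spaces.linear scaleC scaleC T"
    and y: "y \<in> cspan {y. \<exists>\<mu>. cmod \<mu> > cmod c \<and> T y = \<mu> *\<^sub>C y}"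
  shows "\<exists>w. (\<forall>n. (T ^^ n) (w n) = y) \<and> (\<lambda>n. c ^ n *\<^sub>C w n) \<longlonglongrightarrow> 0"
  using y
proof (induction rule: complex_vector.span_induct_alt)
  case base
  have "(T ^^ n) 0 = 0" for n
  proof -
    interpret Vector_Spaces.linear scaleC scaleC "T ^^ n" by (rule clinear_funpow[OF lin])
    show ?thesis by (rule zero)
  qed
  then show ?case by (intro exI[of _ "\<lambda>_. 0"]) simp
next
  case (step b x y)
  then obtain \<mu> where \<mu>: "cmod \<mu> > cmod c" "T x = \<mu> *\<^sub>C x" by blast
  \<comment> \<open>The strict bound \<open>cmod \<mu> > cmod c\<close> excludes 0, which makes the
    division by \<open>\<mu> ^ n\<close> legitimate.\<close>
  then have nz: "\<mu> \<noteq> 0" by auto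
  from step.IH obtain w where w: "\<And>n. (T ^^ n) (w n) = y"
      "(\<lambda>n. c ^ n *\<^sub>C w n) \<longlonglongrightarrow> 0"
    by blast
  define v where "v n = b *\<^sub>C inverse \<mu> ^ n *\<^sub>C x + w n" for n
  have "(T ^^ n) (v n) = b *\<^sub>C x + y" for n
  proof -
    interpret Vector_Spaces.linear scaleC scaleC "T ^^ n" by (rule clinear_funpow[OF lin])
    show ?thesis
      using nz by (simp add: v_def add scale w(1) funpow_eigenvector[OF lin \<mu>(2)] scaleC_scaleC
          flip: power_mult_distrib)
  qed
  moreover have "(\<lambda>n. c ^ n *\<^sub>C v n) \<longlonglongrightarrow> 0"
  proof -
    have "cmod (c * inverse \<mu>) < 1"
      using \<mu>(1) nz by (simp add: norm_divide field_simps)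
    then have "(\<lambda>n. b *\<^sub>C (c * inverse \<mu>) ^ n *\<^sub>C x + c ^ n *\<^sub>C w n) \<longlonglongrightarrow> 0"
      by (intro tendsto_add_zero tendsto_scaleC_zero tendsto_power_scaleC_zero w(2))
    moreover have "c ^ n *\<^sub>C v n = b *\<^sub>C (c * inverse \<mu>) ^ n *\<^sub>C x + c ^ n *\<^sub>C w n" for n
      by (simp add: v_def scaleC_add_right scaleC_scaleC power_mult_distrib mult_ac)
    ultimately show ?thesis by simp
  qed
  ultimately show ?case by blast
qed

theorem theorem2p12:
  fixes T :: "'a::complex_banach \<Rightarrow> 'a"
  assumes "separable_space (euclidean :: 'a topology)"
    and "bounded_clinear T"
    and "\<exists>p::real. p \<ge> 1 \<and>
      closure (cspan {x. \<exists>\<alpha>::complex. cmod \<alpha> < p \<and> T x = \<alpha> *\<^sub>C x}) = UNIV \<and>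
      closure (cspan {y. \<exists>\<mu>::complex. cmod \<mu> > p \<and> T y = \<mu> *\<^sub>C y}) = UNIV"
  shows "compound T"
  unfolding compound_def
proof (intro allI impI, elim conjE)
  fix U V :: "'a set"
  assume U: "open U" "U \<noteq> {}" and V: "open V" "V \<noteq> {}"
  have lin: "Vector_Spaces.linear scaleC scaleC T"
    using assms(2) by (simp add: bounded_clinear_def)
  obtain p :: real where p: "p \<ge> 1"
    and A: "closure (cspan {x. \<exists>\<alpha>. cmod \<alpha> < p \<and> T x = \<alpha> *\<^sub>C x}) = UNIV"
    and B: "closure (cspan {y. \<exists>\<mu>. cmod \<mu> > p \<and> T y = \<mu> *\<^sub>C y}) = UNIV"
    using assms(3) by blast
  \<comment> \<open>The real threshold \<open>p\<close> becomes a complex scalar with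
    \<open>cmod c = p\<close>, so that both decay lemmas apply with the same
    \<open>c\<close>.\<close>
  define c where "c = complex_of_real p"
  have c: "cmod c = p" "c \<noteq> 0" using p by (auto simp: c_def)
  have meets: "\<exists>z. z \<in> W \<and> z \<in> S" if "open W" "W \<noteq> {}" "closure S = UNIV" for W S :: "'a set"
    using open_Int_closure_eq_empty[OF that(1), of S] that(2,3) by auto
  obtain x where x: "x \<in> U" "x \<in> cspan {x. \<exists>\<alpha>. cmod \<alpha> < cmod c \<and> T x = \<alpha> *\<^sub>C x}"
    using meets[OF U A] unfolding c(1) by blast
  obtain y where y: "y \<in> V" "y \<in> cspan {y. \<exists>\<mu>. cmod \<mu> > cmod c \<and> T y = \<mu> *\<^sub>C y}"
    using meets[OF V B] unfolding c(1) by blast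
  obtain w where w: "\<And>n. (T ^^ n) (w n) = y" "(\<lambda>n. c ^ n *\<^sub>C w n) \<longlonglongrightarrow> 0"
    using scaled_backward_orbit_tendsto_zero[OF lin y(2)] by blast
  define u where "u n = x + c ^ n *\<^sub>C w n" for n
  define \<alpha> where "\<alpha> n = inverse c ^ n" for n
  \<comment> \<open>The factors \<open>\<alpha> n\<close> and \<open>c ^ n\<close> cancel, so the
    perturbation of \<open>x\<close> contributes exactly \<open>y\<close> for every
    \<open>n\<close>; only the first summand needs a limit.\<close>
  have image: "(T ^^ n) (\<alpha> n *\<^sub>C u n) = \<alpha> n *\<^sub>C (T ^^ n) x + y" for n
  proof -
    interpret Vector_Spaces.linear scaleC scaleC "T ^^ n" by (rule clinear_funpow[OF lin])
    show ?thesis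
      using c(2) by (simp add: u_def \<alpha>_def add scale w(1) scaleC_add_right scaleC_scaleC scaleC_one
          flip: power_mult_distrib)
  qed
  have "u \<longlonglongrightarrow> x"
    unfolding u_def using tendsto_add[OF tendsto_const w(2)] by simp
  then have "\<forall>\<^sub>F n in sequentially. u n \<in> U"
    using U(1) x(1) by (rule topological_tendstoD)
  moreover have "(\<lambda>n. (T ^^ n) (\<alpha> n *\<^sub>C u n)) \<longlonglongrightarrow> y"
    unfolding image unfolding \<alpha>_def
    using tendsto_add[OF scaled_orbit_tendsto_zero[OF lin c(2) x(2)] tendsto_const] by simp
  then have "\<forall>\<^sub>F n in sequentially. (T ^^ n) (\<alpha> n *\<^sub>C u n) \<in> V"
    using V(1) y(1) by (rule topological_tendstoD)
  ultimately have "\<forall>\<^sub>F n in sequentially. u n \<in> U \<and> (T ^^ n) (\<alpha> n *\<^sub>C u n) \<in> V"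
    by (rule eventually_conj)
  then obtain N where N: "\<And>n. n \<ge> N \<Longrightarrow> u n \<in> U \<and> (T ^^ n) (\<alpha> n *\<^sub>C u n) \<in> V"
    unfolding eventually_sequentially by blast
  \<comment> \<open>Here \<open>p \<ge> 1\<close> is essential: the modulus of
    \<open>\<alpha> n\<close> is \<open>inverse p ^ n\<close>.\<close>
  have "\<alpha> n \<in> cball 0 1 - {0}" for n
    using p c by (simp add: \<alpha>_def norm_power norm_inverse power_le_one inverse_le_1_iff)
  \<comment> \<open>The witness in \<open>U\<close> is \<open>u n\<close>. The maximum with 1 is
    taken because \<open>N\<close> may be 0, whereas \<open>compound\<close> asks for a positive
    threshold.\<close>
  moreover have "(T ^^ n) ` ((\<lambda>x. \<alpha> n *\<^sub>C x) ` U) \<inter> V \<noteq> {}" if "n \<ge> max 1 N" for n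
    using N[of n] that by auto
  ultimately show "\<exists>N\<ge>1. \<exists>\<alpha>::nat \<Rightarrow> complex. (\<forall>n\<ge>1. \<alpha> n \<in> cball 0 1 - {0}) \<and>
      (\<forall>n\<ge>N. (T ^^ n) ` ((\<lambda>x. \<alpha> n *\<^sub>C x) ` U) \<inter> V \<noteq> {})"
    by (intro exI[of _ "max 1 N"] exI[of _ \<alpha>]) auto
qed

end
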